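(* For all $i\ge 1$, $j\ge 0$, if $f^*(i,j)=B$, then $f^*(i,j+1)=B$.
   Context: Let $0<\lambda<\mu$ and costs $c>0$, $d\ge 0$. Interpretation: in a two-queue polling system with Poisson($\lambda$) arrivals, exponential($\mu$) services, exhaustive service and no switch-over times, $(i,j)$ means $i$ customers in the busy queue and $j$ in the idle queue; waiting costs $c$ per unit time in the busy queue and $d$ in the idle queue; $f^*(i,j)=B$ (resp. $I$) means that a customer arriving in state $(i,j)$ joins the busy (resp. idle) queue under the individually optimal policy. Recursion: put $\tau_0(i,j)=i/\mu$ for $i\ge 1,j\ge 0$, and $\tau_n(0,j)=0$ for all $n,j\ge0$. For all $n\ge 0$, $i\ge 1$, $j\ge 0$ define $$\delta_n(i,j)=\begin{cases}(i+1,j) & \text{if } ci/\mu<d\,\tau_n(i,j+1)+cj/\mu,\\ (i,j+1) & \text{if } ci/\mu\ge d\,\tau_n(i,j+1)+cj/\mu,\end{cases}$$ $$\tau_{n+1}(i,j)=\frac{1}{\lambda+\mu}+\frac{\mu}{\lambda+\mu}\tau_n(i-1,j)+\frac{\lambda}{\lambda+\mu}\tau_n(\delta_n(i,j)).$$ The limits $\tau(i,j)=\lim_{n\to\infty}\tau_n(i,j)$ and $\delta(i,j)=\lim_{n\to\infty}\delta_n(i,j)$ (eventually constant) exist, and $f^*$ is defined for $i\ge1$, $j\ge0$ by $f^*(i,j)=B$ if $\delta(i,j)=(i+1,j)$ and $f^*(i,j)=I$ if $\delta(i,j)=(i,j+1)$; equivalently $f^*(i,j)=B\Leftrightarrow ci/\mu<d\,\tau(i,j+1)+cj/\mu$.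 *)

theory Defs
  imports Complex_Main
begin

text \<open>
  States are pairs \<open>(i, j)\<close>: \<open>i\<close> customers in the busy queue, \<open>j\<close> in the idle queue.
  The argument \<open>l\<close> is the arrival rate \<open>\<lambda>\<close>, \<open>m\<close> the service rate \<open>\<mu>\<close>, and \<open>c\<close>, \<open>d\<close> are the
  waiting costs per unit time in the busy and in the idle queue.  The values of \<open>delta_n\<close> with
  \<open>i = 0\<close> are junk and never enter the recursion for \<open>tau_n\<close>.
\<close>

fun tau_n :: "real \<Rightarrow> real \<Rightarrow> real \<Rightarrow> real \<Rightarrow> nat \<Rightarrow> nat \<times> nat \<Rightarrow> real"
  and delta_n :: "real \<Rightarrow> real \<Rightarrow> real \<Rightarrow> real \<Rightarrow> nat \<Rightarrow> nat \<times> nat \<Rightarrow> nat \<times> nat" where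
  "tau_n l m c d 0 (i, j) = (if i = 0 then 0 else real i / m)"
| "tau_n l m c d (Suc n) (i, j) =
     (if i = 0 then 0
      else 1 / (l + m) + m / (l + m) * tau_n l m c d n (i - 1, j)
           + l / (l + m) * tau_n l m c d n (delta_n l m c d n (i, j)))"
| "delta_n l m c d n (i, j) =
     (if c * real i / m < d * tau_n l m c d n (i, j + 1) + c * real j / m
      then (i + 1, j) else (i, j + 1))"

text \<open>
  The topology of \<open>nat \<times> nat\<close> is discrete, so this limit is the eventually constant value of
  the sequence.
\<close>

definition delta :: "real \<Rightarrow> real \<Rightarrow> real \<Rightarrow> real \<Rightarrow> nat \<times> nat \<Rightarrow> nat \<times> nat" where
  "delta l m c d s = lim (\<lambda>n. delta_n l m c d n s)"

datatype queue = Busy | Idle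

text \<open>
  For \<open>i \<ge> 1\<close>, the limit being \<open>(i + 1, j)\<close> or \<open>(i, j + 1)\<close>, the else branch is the case
  \<open>delta l m c d (i, j) = (i, j + 1)\<close>.
\<close>

definition fstar :: "real \<Rightarrow> real \<Rightarrow> real \<Rightarrow> real \<Rightarrow> nat \<times> nat \<Rightarrow> queue" where
  "fstar l m c d = (\<lambda>(i, j). if delta l m c d (i, j) = (i + 1, j) then Busy else Idle)"

end

theory Submission
  imports Defs
begin

text \<open>
  By induction on \<open>n\<close>, moving a customer from the idle to the busy queue never shortens \<open>tau_n\<close>:
  the successor states of \<open>(i, j + 1)\<close> and \<open>(i + 1, j)\<close> all lie on the antidiagonal through
  \<open>(i + 1, j + 1)\<close>.  Hence \<open>tau_n\<close> increases in \<open>n\<close>, a state in which \<open>delta_n\<close> chooses the busy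
  queue keeps that choice for all larger \<open>n\<close>, and the limit chooses the busy queue iff some
  \<open>delta_n\<close> does.  Again by induction on \<open>n\<close>, \<open>tau_n\<close> increases in \<open>j\<close>: monotonicity of \<open>tau_n\<close>
  in \<open>j\<close> says that choosing the busy queue in \<open>(i, j)\<close> forces the same choice in \<open>(i, j + 1)\<close>,
  which excludes the only unfavourable pair of successors in the induction step.
\<close>

context
  fixes l m c d :: real
  assumes l: "0 < l" and m: "0 < m" and c: "0 < c" and d: "0 \<le> d"
begin

abbreviation \<tau> :: "nat \<Rightarrow> nat \<Rightarrow> nat \<Rightarrow> real" where
  "\<tau> n i j \<equiv> tau_n l m c d n (i, j)"

abbreviation \<delta> :: "nat \<Rightarrow> nat \<Rightarrow> nat \<Rightarrow> nat \<times> nat" where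
  "\<delta> n i j \<equiv> delta_n l m c d n (i, j)"

definition joins_busy :: "nat \<Rightarrow> nat \<Rightarrow> nat \<Rightarrow> bool" where
  "joins_busy n i j \<longleftrightarrow> c * real i / m < d * \<tau> n i (Suc j) + c * real j / m"

lemma delta_n_eq: "\<delta> n i j = (if joins_busy n i j then (Suc i, j) else (i, Suc j))"
  by (simp add: joins_busy_def)

lemma tau_n_0_left: "\<tau> n 0 j = 0"
  by (cases n) simp_all

lemma tau_n_Suc_Suc:
  "\<tau> (Suc n) (Suc i) j =
     1 / (l + m) + m / (l + m) * \<tau> n i j + l / (l + m) * tau_n l m c d n (\<delta> n (Suc i) j)"
  by simp

declare tau_n.simps(2) [simp del] delta_n.simps [simp del]

text \<open>The weights of service and arrival are the same in all states, so the comparisons below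
  reduce to the successors.\<close>

lemma tau_n_Suc_mono:
  assumes "\<tau> n i j \<le> \<tau> n' i' j'"
    and "tau_n l m c d n (\<delta> n (Suc i) j) \<le> tau_n l m c d n' (\<delta> n' (Suc i') j')"
  shows "\<tau> (Suc n) (Suc i) j \<le> \<tau> (Suc n') (Suc i') j'"
  unfolding tau_n_Suc_Suc using l m assms by (intro add_mono mult_left_mono) auto

lemma tau_n_nonneg: "0 \<le> \<tau> n i j"
proof (induction n arbitrary: i j)
  case 0
  then show ?case using m by simp
next
  case (Suc n)
  then show ?case
    using l m by (cases i) (auto simp: tau_n_0_left tau_n_Suc_Suc delta_n_eq)
qed

lemma tau_n_shift: "\<tau> n i (Suc j) \<le> \<tau> n (Suc i) j"
proof (induction n arbitrary: i j)
  case 0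
  then show ?case using m by (simp add: divide_right_mono)
next
  case (Suc n)
  show ?case
  proof (cases i)
    case 0
    then show ?thesis by (simp add: tau_n_0_left tau_n_nonneg)
  next
    case (Suc k)
    \<comment> \<open>The first instance compares the states after a service; the other two chain
      the three possible states after an arrival.\<close>
    then show ?thesis
      using Suc.IH[of k j] Suc.IH[of "Suc k" "Suc j"] Suc.IH[of "Suc (Suc k)" j]
      by (auto intro!: tau_n_Suc_mono simp: delta_n_eq)
  qed
qed

lemma tau_n_0_le_tau_n_1: "\<tau> 0 i j \<le> \<tau> (Suc 0) i j"
proof (cases i)
  case (Suc k)
  \<comment> \<open>\<open>i / m\<close> is the fixed point of the recursion if all arrivals join
    the idle queue.\<close>
  have "\<tau> 0 (Suc k) j = 1 / (l + m) + m / (l + m) * (real k / m) + l / (l + m) * (real (Suc k) / m)"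
    using l m by (simp add: divide_simps) (simp add: algebra_simps)
  also have "\<dots> \<le> \<tau> (Suc 0) (Suc k) j"
    unfolding tau_n_Suc_Suc using l m
    by (intro add_mono mult_left_mono) (auto simp: delta_n_eq divide_right_mono)
  finally show ?thesis using Suc by simp
qed (simp add: tau_n_0_left)

text \<open>Used with \<open>j' = j\<close> for growth in \<open>n\<close> and with
  \<open>n' = n\<close> for growth in \<open>j\<close>.\<close>

lemma joins_busy_mono:
  assumes "joins_busy n i j" "\<tau> n i (Suc j) \<le> \<tau> n' i (Suc j')" "j \<le> j'"
  shows "joins_busy n' i j'"
proof -
  have "d * \<tau> n i (Suc j) + c * real j / m \<le> d * \<tau> n' i (Suc j') + c * real j' / m"
    using assms c d m by (intro add_mono mult_left_mono divide_right_mono) auto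
  then show ?thesis using assms(1) by (simp add: joins_busy_def)
qed

lemma tau_n_le_Suc: "\<tau> n i j \<le> \<tau> (Suc n) i j"
proof (induction n arbitrary: i j)
  case 0
  show ?case by (rule tau_n_0_le_tau_n_1)
next
  case (Suc n)
  show ?case
  proof (cases i)
    case 0
    then show ?thesis by (simp add: tau_n_0_left)
  next
    case (Suc k)
    have "joins_busy n i j \<Longrightarrow> joins_busy (Suc n) i j"
      using Suc.IH joins_busy_mono by blast
    \<comment> \<open>The case where the choice switches from idle to busy between \<open>n\<close>
      and \<open>Suc n\<close>.\<close>
    moreover have "\<tau> n i (Suc j) \<le> \<tau> (Suc n) (Suc i) j"
      using Suc.IH tau_n_shift order_trans by blast
    ultimately show ?thesis
      using Suc Suc.IH by (auto intro!: tau_n_Suc_mono simp: delta_n_eq)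
  qed
qed

lemma incseq_tau_n: "incseq (\<lambda>n. \<tau> n i j)"
  by (intro incseq_SucI tau_n_le_Suc)

lemma tau_n_le_Suc_idle: "\<tau> n i j \<le> \<tau> n i (Suc j)"
proof (induction n arbitrary: i j)
  case 0
  then show ?case by simp
next
  case (Suc n)
  show ?case
  proof (cases i)
    case 0
    then show ?thesis by (simp add: tau_n_0_left)
  next
    case (Suc k)
    have "joins_busy n i j \<Longrightarrow> joins_busy n i (Suc j)"
      using Suc.IH joins_busy_mono le_SucI by blast
    \<comment> \<open>The case of idle in \<open>(i, j)\<close> but busy in
      \<open>(i, Suc j)\<close>.\<close>
    moreover have "\<tau> n i (Suc j) \<le> \<tau> n (Suc i) (Suc j)"
      using Suc.IH tau_n_shift order_trans by blast
    ultimately show ?thesis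
      using Suc Suc.IH by (auto intro!: tau_n_Suc_mono simp: delta_n_eq)
  qed
qed

lemma fstar_Busy_iff: "fstar l m c d (i, j) = Busy \<longleftrightarrow> (\<exists>n. joins_busy n i j)"
proof (cases "\<exists>n. joins_busy n i j")
  case True
  then obtain N where N: "joins_busy N i j" ..
  have "\<delta> n i j = (Suc i, j)" if "N \<le> n" for n
    using joins_busy_mono[OF N incseqD[OF incseq_tau_n that]] by (simp add: delta_n_eq)
  then have "delta l m c d (i, j) = (Suc i, j)"
    unfolding delta_def by (intro limI tendsto_eventually eventually_sequentiallyI)
  with True show ?thesis by (simp add: fstar_def)
next
  case False
  then have "delta l m c d (i, j) = (i, Suc j)"
    unfolding delta_def by (simp add: delta_n_eq limI)
  with False show ?thesis by (simp add: fstar_def)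
qed

lemma fstar_Busy_Suc:
  assumes "fstar l m c d (i, j) = Busy"
  shows "fstar l m c d (i, Suc j) = Busy"
proof -
  obtain n where "joins_busy n i j"
    using assms fstar_Busy_iff by blast
  then have "joins_busy n i (Suc j)"
    using tau_n_le_Suc_idle by (rule joins_busy_mono) simp
  then show ?thesis
    using fstar_Busy_iff by blast
qed

end

theorem theorem5p4:
  fixes l m c d :: real and i j :: nat
  assumes "0 < l" and "l < m" and "c > 0" and "d \<ge> 0"
    and "i \<ge> 1"
    and "fstar l m c d (i, j) = Busy"
  shows "fstar l m c d (i, j + 1) = Busy"
  using fstar_Busy_Suc[of l m c d i j] assms by simp

end
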